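(* Let $f\in C([-1,1])$ and let $E[f]:=\lVert f-\hat P_{r,n}[f]\rVert_\infty$. Then $$E[f]\le (1+B_n)\,\lVert f-p_r^\star\rVert_\infty,$$ where $p_r^\star$ is the polynomial of best uniform approximation of $f$ on $[-1,1]$ of degree less than or equal to $r$, and $$B_n:=2(r+1)\,\kappa(M)+(m+1)\lVert M^{-1}\rVert_1,\qquad \kappa(M)=\lVert M\rVert_1\lVert M^{-1}\rVert_1 .$$
   Context: Let $n$ be a (sufficiently large) positive integer and let $X_n=\{-1+\tfrac{2}{n}i : i=0,\dots,n\}$ be the set of $n+1$ equispaced nodes in $[-1,1]$. Put $m=\lfloor \pi\sqrt{n/2}\rfloor$, $p=\lfloor \tfrac{\pi}{\sqrt2}\sqrt{n/6}\rfloor$, $r=m+p+1$; $n$ is large enough that $r\le n$. $\Pi_k$ denotes the space of real polynomials of degree $\le k$. $X'_m=\{x'_0,\dots,x'_m\}\subset X_n$ is the mock-Chebyshev subset: $m+1$ pairwise distinct nodes of $X_n$ that best mimic the Chebyshev--Lobatto nodes, i.e. $x'_k$ is the node of $X_n$ closest to $-\cos(k\pi/m)$ (a neighbouring grid node being used if necessary to keep the nodes distinct). The elements of $X_n$ are reordered as $x_0,\dots,x_n$ so that $x_i=x'_i$ for $i=0,\dots,m$. The basis of $\Pi_r$ used is the Chebyshev basis of the first kind, $u_k(x)=T_k(x)=\cos(k\arccos x)$, $k=0,\dots,r$. Let $V=[T_j(x_i)]_{i=0,\dots,n;\ j=0,\dots,r}$ and $C=[T_j(x_i)]_{i=0,\dots,m;\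 j=0,\dots,r}$. The KKT matrix is $$M=\begin{bmatrix}2V^TV & C^T\\ C&0\end{bmatrix},$$ which is nonsingular. For $f\in C([-1,1])$ let $\boldsymbol b=[f(x_0),\dots,f(x_n)]^T$, $\boldsymbol d=[f(x_0),\dots,f(x_m)]^T$, and let $(\hat{\boldsymbol a},\hat{\boldsymbol z})$ with $\hat{\boldsymbol a}=[\hat a_0,\dots,\hat a_r]^T$, $\hat{\boldsymbol z}\in\mathbb R^{m+1}$, be the unique solution of $$M\begin{bmatrix}\hat{\boldsymbol a}\\ \hat{\boldsymbol z}\end{bmatrix}=\begin{bmatrix}2V^T\boldsymbol b\\ \boldsymbol d\end{bmatrix}.$$ The constrained mock-Chebyshev least squares operator is $\hat P_{r,n}[f](x)=\sum_{i=0}^r\hat a_iT_i(x)$, $x\in[-1,1]$. $\lVert\cdot\rVert_\infty$ is the sup norm on $[-1,1]$; $\lVert\cdot\rVert_1$ of a matrix is the operator norm induced by the vector $1$-norm (maximum absolute column sum). *)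

theory Defs
  imports
    "HOL-Computational_Algebra.Polynomial"
    "Jordan_Normal_Form.Gauss_Jordan_Elimination"
    Complex_Main
begin

definition vec_norm1 :: "real vec \<Rightarrow> real" where
  "vec_norm1 v = (\<Sum>i<dim_vec v. \<bar>v $ i\<bar>)"

definition mat_norm1 :: "real mat \<Rightarrow> real" where
  "mat_norm1 A = Sup {vec_norm1 (A *\<^sub>v v) | v. v \<in> carrier_vec (dim_col A) \<and> vec_norm1 v = 1}"

lemma mat_norm1_eq_max_col_sum:
  assumes "0 < dim_col A"
  shows "mat_norm1 A = Max ((\<lambda>j. \<Sum>i<dim_row A. \<bar>A $$ (i, j)\<bar>) ` {..<dim_col A})"
proof -
  let ?c = "\<lambda>j. \<Sum>i<dim_row A. \<bar>A $$ (i, j)\<bar>"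
  let ?K = "Max (?c ` {..<dim_col A})"
  have ne: "?c ` {..<dim_col A} \<noteq> {}"
    using assms by auto
  have "?K \<in> ?c ` {..<dim_col A}"
    by (rule Max_in) (use ne in auto)
  then obtain j where j: "j < dim_col A" and K: "?K = ?c j"
    by auto
  have unit: "vec_norm1 (unit_vec (dim_col A) j) = 1"
  proof -
    have "vec_norm1 (unit_vec (dim_col A) j) = (\<Sum>i<dim_col A. if i = j then 1 else 0)"
      unfolding vec_norm1_def by (rule sum.cong) (use j in \<open>auto simp: unit_vec_def\<close>)
    then show ?thesis using j by simp
  qed
  have attained: "vec_norm1 (A *\<^sub>v unit_vec (dim_col A) j) = ?K"
    unfolding K vec_norm1_def using j by (auto intro!: sum.cong)
  have bound: "vec_norm1 (A *\<^sub>v v) \<le> ?K"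
    if v: "v \<in> carrier_vec (dim_col A)" and n1: "vec_norm1 v = 1" for v
  proof -
    have dv: "dim_vec v = dim_col A" using v by auto
    have "vec_norm1 (A *\<^sub>v v) = (\<Sum>i<dim_row A. \<bar>\<Sum>k<dim_col A. A $$ (i, k) * v $ k\<bar>)"
      unfolding vec_norm1_def
      by (auto simp: scalar_prod_def dv atLeast0LessThan intro!: sum.cong)
    also have "\<dots> \<le> (\<Sum>i<dim_row A. \<Sum>k<dim_col A. \<bar>A $$ (i, k)\<bar> * \<bar>v $ k\<bar>)"
      by (intro sum_mono order_trans[OF sum_abs]) (simp add: abs_mult)
    also have "\<dots> = (\<Sum>k<dim_col A. ?c k * \<bar>v $ k\<bar>)"
      by (subst sum.swap) (simp add: sum_distrib_right)
    also have "\<dots> \<le> (\<Sum>k<dim_col A. ?K * \<bar>v $ k\<bar>)"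
      by (intro sum_mono mult_right_mono Max_ge) auto
    also have "\<dots> = ?K"
      using n1 by (simp add: vec_norm1_def dv flip: sum_distrib_left)
    finally show ?thesis .
  qed
  show ?thesis
    unfolding mat_norm1_def
  proof (rule cSup_eq_maximum)
    show "?K \<in> {vec_norm1 (A *\<^sub>v v) | v. v \<in> carrier_vec (dim_col A) \<and> vec_norm1 v = 1}"
      using attained unit
      by (intro CollectI exI[of _ "unit_vec (dim_col A) j"]) auto
  qed (use bound in auto)
qed

text \<open>The library inverse is option-valued; the value is meaningful for nonsingular \<open>A\<close> only.\<close>

definition mat_inv :: "real mat \<Rightarrow> real mat" where
  "mat_inv A = the (mat_inverse A)"

definition cond1 :: "real mat \<Rightarrow> real" where
  "cond1 A = mat_norm1 A * mat_norm1 (mat_inv A)"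

definition sup_norm :: "(real \<Rightarrow> real) \<Rightarrow> real" where
  "sup_norm g = (SUP t\<in>{-1..1}. \<bar>g t\<bar>)"

definition best_uniform_approx :: "nat \<Rightarrow> (real \<Rightarrow> real) \<Rightarrow> real poly \<Rightarrow> bool" where
  "best_uniform_approx k f q \<longleftrightarrow>
     degree q \<le> k \<and>
     (\<forall>g. degree g \<le> k \<longrightarrow> sup_norm (\<lambda>t. f t - poly q t) \<le> sup_norm (\<lambda>t. f t - poly g t))"

text \<open>The Chebyshev polynomial of the first kind on \<open>[-1,1]\<close>; outside this interval
  \<^const>\<open>arccos\<close> is unspecified, and the function is not used there.\<close>

definition cheb :: "nat \<Rightarrow> real \<Rightarrow> real" where
  "cheb k t = cos (real k * arccos t)"

definition equi_nodes :: "nat \<Rightarrow> real set" where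
  "equi_nodes n = (\<lambda>i. -1 + 2 / real n * real i) ` {0..n}"

definition m_of :: "nat \<Rightarrow> nat" where
  "m_of n = nat \<lfloor>pi * sqrt (real n / 2)\<rfloor>"

definition p_of :: "nat \<Rightarrow> nat" where
  "p_of n = nat \<lfloor>pi / sqrt 2 * sqrt (real n / 6)\<rfloor>"

definition r_of :: "nat \<Rightarrow> nat" where
  "r_of n = m_of n + p_of n + 1"

definition nearest_node :: "nat \<Rightarrow> real \<Rightarrow> real \<Rightarrow> bool" where
  "nearest_node n t g \<longleftrightarrow> g \<in> equi_nodes n \<and> (\<forall>h\<in>equi_nodes n. \<bar>g - t\<bar> \<le> \<bar>h - t\<bar>)"

text \<open>The node \<open>x' k\<close> is a grid node nearest to \<open>- cos (k \<pi> / m)\<close> (a tie may be resolved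
  either way). A grid neighbour of a nearest node is admitted only if every nearest node is
  already taken by another index.\<close>

definition mock_chebyshev :: "nat \<Rightarrow> nat \<Rightarrow> (nat \<Rightarrow> real) \<Rightarrow> bool" where
  "mock_chebyshev n m x' \<longleftrightarrow>
     x' ` {0..m} \<subseteq> equi_nodes n \<and> inj_on x' {0..m} \<and>
     (\<forall>k\<le>m. let near = nearest_node n (- cos (real k * pi / real m)) in
        near (x' k) \<or>
        ((\<exists>g. near g \<and> \<bar>x' k - g\<bar> = 2 / real n) \<and>
         (\<forall>g. near g \<longrightarrow> (\<exists>l\<le>m. l \<noteq> k \<and> x' l = g))))"

text \<open>The collocation matrix with rows \<open>x 0, \<dots>, x k\<close> and columns
  \<open>cheb 0, \<dots>, cheb r\<close>.\<close>

definition cheb_mat :: "(nat \<Rightarrow> real) \<Rightarrow> nat \<Rightarrow> nat \<Rightarrow> real mat" where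
  "cheb_mat x k r = mat (k + 1) (r + 1) (\<lambda>(i, j). cheb j (x i))"

definition sample_vec :: "(nat \<Rightarrow> real) \<Rightarrow> nat \<Rightarrow> (real \<Rightarrow> real) \<Rightarrow> real vec" where
  "sample_vec x k f = vec (k + 1) (\<lambda>i. f (x i))"

definition kkt_mat :: "(nat \<Rightarrow> real) \<Rightarrow> nat \<Rightarrow> nat \<Rightarrow> nat \<Rightarrow> real mat" where
  "kkt_mat x n m r =
     (let V = cheb_mat x n r; C = cheb_mat x m r in
      four_block_mat (2 \<cdot>\<^sub>m (transpose_mat V * V)) (transpose_mat C) C (0\<^sub>m (m + 1) (m + 1)))"

definition kkt_rhs :: "(nat \<Rightarrow> real) \<Rightarrow> nat \<Rightarrow> nat \<Rightarrow> nat \<Rightarrow> (real \<Rightarrow> real) \<Rightarrow> real vec" where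
  "kkt_rhs x n m r f =
     (2 \<cdot>\<^sub>v (transpose_mat (cheb_mat x n r) *\<^sub>v sample_vec x n f)) @\<^sub>v sample_vec x m f"

definition kkt_solution ::
    "(nat \<Rightarrow> real) \<Rightarrow> nat \<Rightarrow> nat \<Rightarrow> nat \<Rightarrow> (real \<Rightarrow> real) \<Rightarrow> real vec \<times> real vec" where
  "kkt_solution x n m r f =
     (THE (a, z). a \<in> carrier_vec (r + 1) \<and> z \<in> carrier_vec (m + 1) \<and>
        kkt_mat x n m r *\<^sub>v (a @\<^sub>v z) = kkt_rhs x n m r f)"

definition mock_cheb_ls ::
    "(nat \<Rightarrow> real) \<Rightarrow> nat \<Rightarrow> nat \<Rightarrow> nat \<Rightarrow> (real \<Rightarrow> real) \<Rightarrow> real \<Rightarrow> real" where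
  "mock_cheb_ls x n m r f t = (\<Sum>i=0..r. fst (kkt_solution x n m r f) $ i * cheb i t)"

end

theory Submission
  imports Defs "Jordan_Normal_Form.Determinant"
begin

text \<open>The operator reproduces polynomials of degree at most \<open>r\<close>: such a polynomial has a
  Chebyshev coefficient vector \<open>c\<close>, and \<open>(c, 0)\<close> solves the KKT system for it. By linearity
  the coefficients of \<open>P[f] - p\<close> are the first block of \<open>M\<inverse>\<close> applied to the right-hand side
  of \<open>f - p\<close>. Since \<open>\<bar>T\<^sub>j\<bar> \<le> 1\<close>, the sup norm of \<open>P[f] - p\<close> is at most the 1-norm of
  its coefficients, and the right-hand side has 1-norm at most
  \<open>(2 (r + 1) (n + 1) + (m + 1)) \<epsilon>\<close>, where \<open>\<epsilon>\<close> is the sup norm of \<open>f - p\<close>. The entry of \<open>M\<close>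
  at position \<open>(0, 0)\<close> is \<open>2 (n + 1)\<close> because \<open>T\<^sub>0 = 1\<close>; hence \<open>n + 1\<close> is at most the 1-norm
  of \<open>M\<close>.

  \<open>M\<close> is nonsingular: \<open>M (a, z) = 0\<close> gives \<open>C a = 0\<close> and, after pairing the first block with
  \<open>a\<close>, also \<open>V a = 0\<close>, so a polynomial of degree at most \<open>r \<le> n\<close> has \<open>n + 1\<close> zeros. Then
  \<open>C\<^sup>T z = 0\<close>, and testing against the Lagrange polynomials of the first \<open>m + 1\<close> nodes gives
  \<open>z = 0\<close>.\<close>

section \<open>Chebyshev polynomials\<close>

text \<open>The three-term recurrence gives a genuine polynomial, so that degrees, coefficients and
  root counts apply; \<open>cheb\<close> is only a real function built from
  \<open>arccos\<close>.\<close>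

fun cheb_poly :: "nat \<Rightarrow> real poly" where
  "cheb_poly 0 = 1"
| "cheb_poly (Suc 0) = [:0, 1:]"
| "cheb_poly (Suc (Suc k)) = [:0, 2:] * cheb_poly (Suc k) - cheb_poly k"

text \<open>The recurrence is the product-to-sum formula for \<open>cos\<close> at the angles
  \<open>(k + 1) * arccos t\<close> and \<open>arccos t\<close>; the interval is where
  \<open>cos (arccos t) = t\<close>.\<close>

lemma poly_cheb_poly:
  assumes "t \<in> {-1..1}"
  shows "poly (cheb_poly k) t = cheb k t"
proof (induction k rule: cheb_poly.induct)
  case (3 k)
  let ?a = "arccos t"
  have "cos (real (Suc (Suc k)) * ?a) + cos (real k * ?a)
      = 2 * cos (real (Suc k) * ?a) * cos ?a"
    using cos_times_cos[of "real (Suc k) * ?a" ?a] by (simp add: algebra_simps)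
  moreover have "cos ?a = t"
    using assms by simp
  ultimately show ?case
    using 3 by (simp add: cheb_def algebra_simps)
qed (use assms in \<open>auto simp: cheb_def\<close>)

lemma abs_cheb_le_1: "\<bar>cheb k t\<bar> \<le> 1"
  by (simp add: cheb_def)

lemma degree_cheb_poly [simp]: "degree (cheb_poly k) = k"
proof (induction k rule: cheb_poly.induct)
  case (3 k)
  have "cheb_poly (Suc k) \<noteq> 0"
    using 3 by (metis degree_0 nat.distinct(1))
  then have "degree ([:0, 2:] * cheb_poly (Suc k)) = Suc (Suc k)"
    using 3 by (subst degree_mult_eq) auto
  then show ?case
    using 3 degree_add_eq_left[of "- cheb_poly k" "[:0, 2:] * cheb_poly (Suc k)"] by simp
qed auto

lemma coeff_cheb_poly_neq_0: "coeff (cheb_poly k) k \<noteq> 0"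
proof -
  have "cheb_poly k \<noteq> 0"
    by (cases k) (auto, metis degree_cheb_poly degree_0 nat.distinct(1))
  then show ?thesis
    using leading_coeff_0_iff[of "cheb_poly k"] by simp
qed

text \<open>One polynomial in each degree makes a triangular basis: a multiple of the last one
  cancels the top coefficient, and induction handles the remainder.\<close>

lemma cheb_poly_span:
  assumes "degree q \<le> k"
  shows "\<exists>c. q = (\<Sum>j\<le>k. Polynomial.smult (c j) (cheb_poly j))"
  using assms
proof (induction k arbitrary: q)
  case 0
  then obtain a where "q = [:a:]"
    by (auto elim: degree_eq_zeroE)
  then show ?case
    by (intro exI[of _ "\<lambda>_. a"]) simp
next
  case (Suc k)
  define b where "b = coeff q (Suc k) / coeff (cheb_poly (Suc k)) (Suc k)"
  let ?q = "q - Polynomial.smult b (cheb_poly (Suc k))"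
  have "coeff ?q i = 0" if "i > k" for i
  proof (cases "i = Suc k")
    case True
    then show ?thesis
      using coeff_cheb_poly_neq_0[of "Suc k"] by (simp add: b_def del: cheb_poly.simps)
  next
    case False
    then show ?thesis
      using that Suc.prems by (simp add: coeff_eq_0 del: cheb_poly.simps)
  qed
  then have "degree ?q \<le> k"
    by (intro degree_le) auto
  from Suc.IH[OF this] obtain c where c: "?q = (\<Sum>j\<le>k. Polynomial.smult (c j) (cheb_poly j))"
    by blast
  have "q = ?q + Polynomial.smult b (cheb_poly (Suc k))"
    by simp
  also have "\<dots> = (\<Sum>j\<le>Suc k. Polynomial.smult ((c(Suc k := b)) j) (cheb_poly j))"
    unfolding c by (simp del: cheb_poly.simps)
  finally show ?case
    by blast
qed

lemma cheb_poly_independent: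
  assumes "(\<Sum>j\<le>k. Polynomial.smult (c j) (cheb_poly j)) = 0" "j \<le> k"
  shows "c j = 0"
  using assms
proof (induction k)
  case 0
  then show ?case by simp
next
  case (Suc k)
  \<comment> \<open>The earlier summands have degree at most \<open>k\<close>, so the coefficient of
    index \<open>Suc k\<close> isolates \<open>c (Suc k)\<close>.\<close>
  have "coeff (\<Sum>j\<le>k. Polynomial.smult (c j) (cheb_poly j)) (Suc k) = 0"
    by (simp add: coeff_sum coeff_eq_0)
  then have "c (Suc k) * coeff (cheb_poly (Suc k)) (Suc k) = 0"
    using arg_cong[OF Suc.prems(1), of "\<lambda>p. coeff p (Suc k)"]
    by (simp del: cheb_poly.simps)
  then have "c (Suc k) = 0"
    using coeff_cheb_poly_neq_0 by (simp del: cheb_poly.simps)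
  then show ?case
    using Suc by (cases "j = Suc k") auto
qed

lemma cheb_span:
  assumes "degree q \<le> r"
  obtains c where "c \<in> carrier_vec (r + 1)"
    "\<And>t. t \<in> {-1..1} \<Longrightarrow> (\<Sum>j\<le>r. c $ j * cheb j t) = poly q t"
proof -
  obtain c where c: "q = (\<Sum>j\<le>r. Polynomial.smult (c j) (cheb_poly j))"
    using cheb_poly_span[OF assms] by blast
  show ?thesis
    by (rule that[of "vec (r + 1) c"]) (auto simp: c poly_sum poly_cheb_poly)
qed

section \<open>The 1-norm\<close>

lemma vec_norm1_append: "vec_norm1 (u @\<^sub>v v) = vec_norm1 u + vec_norm1 v"
proof -
  have "{..<dim_vec u + dim_vec v} = {..<dim_vec u} \<union> {dim_vec u..<dim_vec u + dim_vec v}"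
    by auto
  then have "vec_norm1 (u @\<^sub>v v)
      = vec_norm1 u + (\<Sum>i=dim_vec u..<dim_vec u + dim_vec v. \<bar>v $ (i - dim_vec u)\<bar>)"
    unfolding vec_norm1_def by (simp add: sum.union_disjoint ivl_disj_int)
  also have "(\<Sum>i=dim_vec u..<dim_vec u + dim_vec v. \<bar>v $ (i - dim_vec u)\<bar>) = vec_norm1 v"
    unfolding vec_norm1_def
    by (rule sum.reindex_bij_witness[of _ "\<lambda>i. i + dim_vec u" "\<lambda>i. i - dim_vec u"]) auto
  finally show ?thesis .
qed

lemma vec_norm1_nonneg: "0 \<le> vec_norm1 v"
  by (simp add: vec_norm1_def sum_nonneg)

lemma vec_norm1_le:
  assumes "\<And>i. i < dim_vec v \<Longrightarrow> \<bar>v $ i\<bar> \<le> c"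
  shows "vec_norm1 v \<le> real (dim_vec v) * c"
  unfolding vec_norm1_def using sum_bounded_above[of "{..<dim_vec v}" "\<lambda>i. \<bar>v $ i\<bar>" c] assms
  by simp

lemma col_sum_le_mat_norm1:
  assumes "j < dim_col A"
  shows "(\<Sum>i<dim_row A. \<bar>A $$ (i, j)\<bar>) \<le> mat_norm1 A"
proof -
  have "mat_norm1 A = Max ((\<lambda>j. \<Sum>i<dim_row A. \<bar>A $$ (i, j)\<bar>) ` {..<dim_col A})"
    using assms by (intro mat_norm1_eq_max_col_sum) auto
  then show ?thesis
    using assms by (auto intro!: Max_ge)
qed

text \<open>Also the source of \<open>0 \<le> mat_norm1 A\<close> for a matrix with an entry, which
  the definition by \<open>Sup\<close> does not show directly.\<close>

lemma abs_entry_le_mat_norm1: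
  assumes "i < dim_row A" "j < dim_col A"
  shows "\<bar>A $$ (i, j)\<bar> \<le> mat_norm1 A"
proof -
  have "\<bar>A $$ (i, j)\<bar> \<le> (\<Sum>i<dim_row A. \<bar>A $$ (i, j)\<bar>)"
    using assms by (intro member_le_sum) auto
  then show ?thesis
    using col_sum_le_mat_norm1[OF assms(2)] by simp
qed

text \<open>Exchanging the sums groups the bound by columns, each weighted by an entry of
  \<open>v\<close>. Arguing for arbitrary \<open>v\<close> avoids normalising and a separate case
  for the zero vector.\<close>

lemma vec_norm1_mult_mat_vec_le:
  assumes "v \<in> carrier_vec (dim_col A)"
  shows "vec_norm1 (A *\<^sub>v v) \<le> mat_norm1 A * vec_norm1 v"
proof -
  have dv: "dim_vec v = dim_col A"
    using assms by auto
  have "vec_norm1 (A *\<^sub>v v) = (\<Sum>i<dim_row A. \<bar>\<Sum>k<dim_col A. A $$ (i, k) * v $ k\<bar>)"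
    unfolding vec_norm1_def
    by (auto simp: scalar_prod_def dv atLeast0LessThan intro!: sum.cong)
  also have "\<dots> \<le> (\<Sum>i<dim_row A. \<Sum>k<dim_col A. \<bar>A $$ (i, k)\<bar> * \<bar>v $ k\<bar>)"
    by (intro sum_mono order_trans[OF sum_abs]) (simp add: abs_mult)
  also have "\<dots> = (\<Sum>k<dim_col A. (\<Sum>i<dim_row A. \<bar>A $$ (i, k)\<bar>) * \<bar>v $ k\<bar>)"
    by (subst sum.swap) (simp add: sum_distrib_right)
  also have "\<dots> \<le> (\<Sum>k<dim_col A. mat_norm1 A * \<bar>v $ k\<bar>)"
    by (intro sum_mono mult_right_mono col_sum_le_mat_norm1) auto
  also have "\<dots> = mat_norm1 A * vec_norm1 v"
    by (simp add: vec_norm1_def dv flip: sum_distrib_left)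
  finally show ?thesis .
qed

text \<open>A trivial kernel makes the determinant nonzero and \<open>A\<close> a unit of the matrix
  ring, so \<open>mat_inverse\<close> returns \<open>Some\<close> and \<open>the\<close> is
  meaningful.\<close>

lemma mat_inv_inverts:
  assumes A: "A \<in> carrier_mat k k"
    and inj: "\<And>v. v \<in> carrier_vec k \<Longrightarrow> A *\<^sub>v v = 0\<^sub>v k \<Longrightarrow> v = 0\<^sub>v k"
  shows "A * mat_inv A = 1\<^sub>m k" "mat_inv A * A = 1\<^sub>m k" "mat_inv A \<in> carrier_mat k k"
proof -
  have "det A \<noteq> 0"
    using det_0_iff_vec_prod_zero_field[OF A] inj by blast
  then have "A \<in> Units (ring_mat TYPE(real) k ())"
    by (rule det_non_zero_imp_unit[OF A])
  then obtain B where B: "mat_inverse A = Some B"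
    using mat_inverse(1)[OF A, of "()"] by (cases "mat_inverse A") auto
  then have "mat_inv A = B"
    by (simp add: mat_inv_def)
  then show "A * mat_inv A = 1\<^sub>m k" "mat_inv A * A = 1\<^sub>m k" "mat_inv A \<in> carrier_mat k k"
    using mat_inverse(2)[OF A B] by auto
qed

section \<open>The KKT system\<close>

lemma cheb_mat_carrier: "cheb_mat x k r \<in> carrier_mat (k + 1) (r + 1)"
  by (simp add: cheb_mat_def)

text \<open>The simplifier turns \<open>k + 1\<close> into \<open>Suc k\<close>, so the simp rule
  has to be stated in that form.\<close>

lemmas cheb_mat_carrier_Suc [simp] = cheb_mat_carrier[simplified]

lemma cheb_mat_mult_vec:
  assumes "c \<in> carrier_vec (r + 1)"
  shows "cheb_mat x k r *\<^sub>v c = sample_vec x k (\<lambda>t. \<Sum>j\<le>r. c $ j * cheb j t)"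
  using assms
  by (intro eq_vecI)
    (auto simp: cheb_mat_def sample_vec_def scalar_prod_def atLeast0LessThan lessThan_Suc_atMost
      mult.commute)

lemma kkt_mat_carrier: "kkt_mat x n m r \<in> carrier_mat (r + m + 2) (r + m + 2)"
  by (simp add: kkt_mat_def Let_def cheb_mat_def four_block_mat_def)

lemma smult_mat_mult_vec:
  fixes A :: "'a :: comm_ring_1 mat"
  assumes "A \<in> carrier_mat nr nc" "v \<in> carrier_vec nc"
  shows "(k \<cdot>\<^sub>m A) *\<^sub>v v = k \<cdot>\<^sub>v (A *\<^sub>v v)"
  using assms by (intro eq_vecI) (auto simp: scalar_prod_def sum_distrib_left mult.assoc)

lemma kkt_mat_mult_vec:
  assumes a: "a \<in> carrier_vec (r + 1)" and z: "z \<in> carrier_vec (m + 1)"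
  shows "kkt_mat x n m r *\<^sub>v (a @\<^sub>v z)
    = (2 \<cdot>\<^sub>v (transpose_mat (cheb_mat x n r) *\<^sub>v (cheb_mat x n r *\<^sub>v a))
        + transpose_mat (cheb_mat x m r) *\<^sub>v z)
      @\<^sub>v (cheb_mat x m r *\<^sub>v a)"
proof -
  let ?V = "cheb_mat x n r" and ?C = "cheb_mat x m r"
  have VV: "transpose_mat ?V * ?V \<in> carrier_mat (r + 1) (r + 1)"
    by (rule mult_carrier_mat[of _ _ "n + 1"]) auto
  have "kkt_mat x n m r *\<^sub>v (a @\<^sub>v z)
    = (2 \<cdot>\<^sub>m (transpose_mat ?V * ?V) *\<^sub>v a + transpose_mat ?C *\<^sub>v z)
      @\<^sub>v (?C *\<^sub>v a + 0\<^sub>m (m + 1) (m + 1) *\<^sub>v z)"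
    unfolding kkt_mat_def Let_def
    by (rule four_block_mat_mult_vec[OF _ _ _ _ a z, of _ "r + 1"]) (use VV in auto)
  moreover have "2 \<cdot>\<^sub>m (transpose_mat ?V * ?V) *\<^sub>v a = 2 \<cdot>\<^sub>v (transpose_mat ?V *\<^sub>v (?V *\<^sub>v a))"
    using a assoc_mult_mat_vec[of "transpose_mat ?V" "r + 1" "n + 1" ?V "r + 1" a]
    by (simp add: smult_mat_mult_vec[OF VV])
  moreover have "?C *\<^sub>v a + 0\<^sub>m (m + 1) (m + 1) *\<^sub>v z = ?C *\<^sub>v a"
    using z a by (intro eq_vecI) (auto simp: cheb_mat_def)
  ultimately show ?thesis
    by simp
qed

text \<open>With multiplier zero the first block reads as the normal equations and the second as
  interpolation; samples of the Chebyshev sum itself satisfy both exactly.\<close>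

lemma kkt_mat_mult_coeffs:
  assumes c: "c \<in> carrier_vec (r + 1)"
  shows "kkt_mat x n m r *\<^sub>v (c @\<^sub>v 0\<^sub>v (m + 1))
    = kkt_rhs x n m r (\<lambda>t. \<Sum>j\<le>r. c $ j * cheb j t)"
proof -
  have "transpose_mat (cheb_mat x m r) *\<^sub>v 0\<^sub>v (m + 1) = 0\<^sub>v (r + 1)"
    by (intro eq_vecI) (auto simp: cheb_mat_def)
  moreover have "transpose_mat (cheb_mat x n r) *\<^sub>v w \<in> carrier_vec (r + 1)" for w
    by (simp add: cheb_mat_def carrier_vecI)
  ultimately show ?thesis
    unfolding kkt_mat_mult_vec[OF c zero_carrier_vec] kkt_rhs_def cheb_mat_mult_vec[OF c]
    by simp
qed

section \<open>Size of the right-hand sides and of the KKT matrix\<close>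

lemma kkt_rhs_diff:
  "kkt_rhs x n m r (\<lambda>t. f t - g t) = kkt_rhs x n m r f - kkt_rhs x n m r g"
  by (intro eq_vecI)
    (auto simp: kkt_rhs_def sample_vec_def cheb_mat_def scalar_prod_def sum_subtractf algebra_simps)

lemma kkt_rhs_carrier: "kkt_rhs x n m r g \<in> carrier_vec (r + m + 2)"
  by (rule carrier_vecI) (simp add: kkt_rhs_def cheb_mat_def sample_vec_def)

text \<open>Only values at the nodes enter. This lets a polynomial be exchanged for its Chebyshev
  sum, which agrees with it on \<open>{-1..1}\<close>.\<close>

lemma kkt_rhs_cong:
  assumes "m \<le> n" "\<And>i. i \<le> n \<Longrightarrow> f (x i) = g (x i)"
  shows "kkt_rhs x n m r f = kkt_rhs x n m r g"
proof -
  have "sample_vec x n f = sample_vec x n g" "sample_vec x m f = sample_vec x m g"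
    using assms by (auto simp: sample_vec_def)
  then show ?thesis
    by (simp add: kkt_rhs_def)
qed

text \<open>The upper block has \<open>r + 1\<close> entries, each twice a sum of
  \<open>n + 1\<close> terms of size at most \<open>e\<close>; the lower block has
  \<open>m + 1\<close> samples of size at most \<open>e\<close>.\<close>

lemma vec_norm1_kkt_rhs_le:
  assumes "m \<le> n" and e: "\<And>i. i \<le> n \<Longrightarrow> \<bar>g (x i)\<bar> \<le> e"
  shows "vec_norm1 (kkt_rhs x n m r g) \<le> (2 * real (r + 1) * real (n + 1) + real (m + 1)) * e"
proof -
  let ?u = "2 \<cdot>\<^sub>v (transpose_mat (cheb_mat x n r) *\<^sub>v sample_vec x n g)"
  have "\<bar>?u $ j\<bar> \<le> 2 * real (n + 1) * e" if "j < dim_vec ?u" for j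
  proof -
    have "\<bar>?u $ j\<bar> = 2 * \<bar>\<Sum>i<n + 1. cheb j (x i) * g (x i)\<bar>"
      using that
      by (simp add: cheb_mat_def sample_vec_def scalar_prod_def atLeast0LessThan abs_mult
          flip: distrib_left del: sum.lessThan_Suc)
    also have "\<bar>\<Sum>i<n + 1. cheb j (x i) * g (x i)\<bar> \<le> (\<Sum>i<n + 1. 1 * e)"
      by (intro order_trans[OF sum_abs] sum_mono, unfold abs_mult)
        (intro mult_mono abs_cheb_le_1 e, auto)
    finally show ?thesis
      by (simp add: algebra_simps)
  qed
  then have "vec_norm1 ?u \<le> real (dim_vec ?u) * (2 * real (n + 1) * e)"
    by (rule vec_norm1_le)
  moreover have "dim_vec ?u = r + 1"
    by (simp add: cheb_mat_def)
  moreover have "vec_norm1 (sample_vec x m g) \<le> real (dim_vec (sample_vec x m g)) * e"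
    using assms by (intro vec_norm1_le) (auto simp: sample_vec_def)
  ultimately show ?thesis
    by (simp add: kkt_rhs_def vec_norm1_append sample_vec_def algebra_simps)
qed

text \<open>Serves to trade the number of nodes for the norm of the matrix, which is how the
  condition number enters the final bound.\<close>

lemma Suc_n_le_mat_norm1_kkt_mat: "real (n + 1) \<le> mat_norm1 (kkt_mat x n m r)"
proof -
  have "kkt_mat x n m r $$ (0, 0) = 2 * real (n + 1)"
    by (simp add: kkt_mat_def Let_def cheb_mat_def four_block_mat_def scalar_prod_def cheb_def)
  moreover have "\<bar>kkt_mat x n m r $$ (0, 0)\<bar> \<le> mat_norm1 (kkt_mat x n m r)"
    by (rule abs_entry_le_mat_norm1) (use kkt_mat_carrier[of x n m r] in auto)
  ultimately show ?thesis
    by simp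
qed

section \<open>Nonsingularity of the KKT matrix\<close>

lemma cheb_sum_eq_0:
  assumes "inj_on x {0..n}" "x ` {0..n} \<subseteq> {-1..1}" "r \<le> n"
    and c: "c \<in> carrier_vec (r + 1)"
    and zero: "\<And>i. i \<le> n \<Longrightarrow> (\<Sum>j\<le>r. c $ j * cheb j (x i)) = 0"
  shows "c = 0\<^sub>v (r + 1)"
proof -
  define q where "q = (\<Sum>j\<le>r. Polynomial.smult (c $ j) (cheb_poly j))"
  have "degree q \<le> r"
    unfolding q_def by (intro degree_sum_le) (auto intro: order_trans[OF degree_smult_le])
  moreover have "poly q (x i) = 0" if "i \<le> n" for i
  proof -
    have "x i \<in> {-1..1}"
      using assms(2) that by (simp add: image_subset_iff)
    then show ?thesis
      using zero[OF that] by (simp add: q_def poly_sum poly_cheb_poly)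
  qed
  then have "x ` {0..n} \<subseteq> {t. poly q t = 0}"
    by auto
  moreover have "card (x ` {0..n}) = n + 1"
    using assms(1) by (simp add: card_image)
  \<comment> \<open>A nonzero \<open>q\<close> would have at most \<open>r\<close> roots, fewer than
    the \<open>n + 1\<close> distinct nodes.\<close>
  ultimately have "q = 0"
    using card_poly_roots_bound[of q] card_mono[of "{t. poly q t = 0}" "x ` {0..n}"]
      poly_roots_finite[of q] assms(3) by fastforce
  then have "c $ j = 0" if "j \<le> r" for j
    using cheb_poly_independent[OF _ that] by (simp add: q_def)
  then show ?thesis
    using c by (intro eq_vecI) auto
qed

text \<open>Dual to the solvability of interpolation: polynomials of degree \<open>m \<le> r\<close>
  take arbitrary values at \<open>m + 1\<close> distinct nodes, so the rows of the matrix are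
  independent.\<close>

lemma transpose_cheb_mat_injective:
  assumes "inj_on x {0..m}" "x ` {0..m} \<subseteq> {-1..1}" "m \<le> r"
    and z: "z \<in> carrier_vec (m + 1)"
    and zero: "transpose_mat (cheb_mat x m r) *\<^sub>v z = 0\<^sub>v (r + 1)"
  shows "z = 0\<^sub>v (m + 1)"
proof (intro eq_vecI)
  fix k assume "k < dim_vec (0\<^sub>v (m + 1) :: real vec)"
  then have k: "k \<le> m"
    by simp
  \<comment> \<open>The Lagrange polynomial of node \<open>x k\<close> without its normalising
    factor; it vanishes at the other nodes, so pairing with \<open>z\<close> isolates
    \<open>z $ k\<close>.\<close>
  define q where "q = (\<Prod>i\<in>{0..m} - {k}. [:- x i, 1:])"
  have "degree q \<le> m"
    unfolding q_def using k by (subst degree_prod_eq_sum_degree) auto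
  then have "degree q \<le> r"
    using assms(3) by simp
  then obtain c where c: "c \<in> carrier_vec (r + 1)"
    and q: "\<And>t. t \<in> {-1..1} \<Longrightarrow> (\<Sum>j\<le>r. c $ j * cheb j t) = poly q t"
    by (rule cheb_span) blast
  have "sample_vec x m (\<lambda>t. \<Sum>j\<le>r. c $ j * cheb j t) = sample_vec x m (poly q)"
    using assms(2) q by (auto simp: sample_vec_def image_subset_iff)
  then have "cheb_mat x m r *\<^sub>v c = sample_vec x m (poly q)"
    using cheb_mat_mult_vec[OF c] by simp
  \<comment> \<open>Moving the transpose across the scalar product turns the left side into the
    pairing of the zero vector with \<open>c\<close>.\<close>
  then have "z \<bullet> sample_vec x m (poly q) = 0"
    using transpose_vec_mult_scalar[OF cheb_mat_carrier c z, of x]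
      scalar_prod_left_zero[OF c] zero by simp
  moreover have "z \<bullet> sample_vec x m (poly q) = (\<Sum>i\<le>m. z $ i * poly q (x i))"
    by (simp add: scalar_prod_def sample_vec_def atLeast0LessThan lessThan_Suc_atMost)
  moreover have "(\<Sum>i\<le>m. z $ i * poly q (x i)) = (\<Sum>i\<in>{k}. z $ i * poly q (x i))"
    using k by (intro sum.mono_neutral_right) (auto simp: q_def poly_prod)
  moreover have "poly q (x k) \<noteq> 0"
    using assms(1) k by (auto simp: q_def poly_prod inj_on_def)
  ultimately show "z $ k = 0\<^sub>v (m + 1) $ k"
    using k by simp
qed (use z in simp)

lemma kkt_mat_injective:
  assumes inj: "inj_on x {0..n}" and range: "x ` {0..n} \<subseteq> {-1..1}"
    and "m \<le> r" "r \<le> n"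
    and v: "v \<in> carrier_vec (r + m + 2)"
    and zero: "kkt_mat x n m r *\<^sub>v v = 0\<^sub>v (r + m + 2)"
  shows "v = 0\<^sub>v (r + m + 2)"
proof -
  let ?V = "cheb_mat x n r" and ?C = "cheb_mat x m r"
  define a where "a = vec_first v (r + 1)"
  define z where "z = vec_last v (m + 1)"
  have a: "a \<in> carrier_vec (r + 1)" and z: "z \<in> carrier_vec (m + 1)"
    by (simp_all add: a_def z_def)
  have "v \<in> carrier_vec ((r + 1) + (m + 1))"
    using v by simp
  then have v_eq: "v = a @\<^sub>v z"
    by (simp add: a_def z_def)
  have zero_split: "0\<^sub>v (r + m + 2) = 0\<^sub>v (r + 1) @\<^sub>v (0\<^sub>v (m + 1) :: real vec)"
    by (intro eq_vecI) auto
  let ?u = "2 \<cdot>\<^sub>v (transpose_mat ?V *\<^sub>v (?V *\<^sub>v a)) + transpose_mat ?C *\<^sub>v z"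
  have u: "?u \<in> carrier_vec (r + 1)"
    by (intro add_carrier_vec smult_carrier_vec[THEN iffD2])
      (auto simp: cheb_mat_def intro!: carrier_vecI)
  have "?u @\<^sub>v (?C *\<^sub>v a) = 0\<^sub>v (r + 1) @\<^sub>v 0\<^sub>v (m + 1)"
    using zero kkt_mat_mult_vec[OF a z, of x n] v_eq zero_split by simp
  \<comment> \<open>An equation of concatenated vectors splits blockwise because the first blocks
    have the same length, by \<open>u\<close>.\<close>
  then have u0: "?u = 0\<^sub>v (r + 1)" and Ca: "?C *\<^sub>v a = 0\<^sub>v (m + 1)"
    using append_vec_eq[OF u] by auto
  have Va: "?V *\<^sub>v a \<in> carrier_vec (n + 1)"
    by (simp add: cheb_mat_def carrier_vecI)
  have VVa: "transpose_mat ?V *\<^sub>v (?V *\<^sub>v a) \<in> carrier_vec (r + 1)"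
    and Cz: "transpose_mat ?C *\<^sub>v z \<in> carrier_vec (r + 1)"
    by (auto simp: cheb_mat_def intro!: carrier_vecI)
  have "0 = ?u \<bullet> a"
    using u0 a by simp
  also have "\<dots> = 2 * ((transpose_mat ?V *\<^sub>v (?V *\<^sub>v a)) \<bullet> a) + (transpose_mat ?C *\<^sub>v z) \<bullet> a"
    using VVa Cz a by (subst add_scalar_prod_distrib[of _ "r + 1"]) auto
  also have "\<dots> = 2 * ((?V *\<^sub>v a) \<bullet> (?V *\<^sub>v a)) + z \<bullet> (?C *\<^sub>v a)"
    by (simp only: transpose_vec_mult_scalar[OF cheb_mat_carrier a Va]
        transpose_vec_mult_scalar[OF cheb_mat_carrier a z])
  also have "z \<bullet> (?C *\<^sub>v a) = 0"
    using Ca z by simp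
  finally have "(?V *\<^sub>v a) \<bullet> (?V *\<^sub>v a) = 0"
    by simp
  then have "?V *\<^sub>v a = 0\<^sub>v (n + 1)"
    using conjugate_square_eq_0_vec[OF Va] by simp
  then have "(\<Sum>j\<le>r. a $ j * cheb j (x i)) = 0" if "i \<le> n" for i
    using arg_cong[OF cheb_mat_mult_vec[OF a, of x n], of "\<lambda>w. w $ i"] that
    by (simp add: sample_vec_def)
  then have a0: "a = 0\<^sub>v (r + 1)"
    using cheb_sum_eq_0[OF inj range \<open>r \<le> n\<close> a] by blast
  have "transpose_mat ?V *\<^sub>v 0\<^sub>v (n + 1) = 0\<^sub>v (r + 1)"
    by (intro eq_vecI) (auto simp: cheb_mat_def)
  moreover have "2 \<cdot>\<^sub>v 0\<^sub>v (r + 1) = (0\<^sub>v (r + 1) :: real vec)"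
    by (intro eq_vecI) auto
  ultimately have "transpose_mat ?C *\<^sub>v z = 0\<^sub>v (r + 1)"
    using u0 Cz \<open>?V *\<^sub>v a = 0\<^sub>v (n + 1)\<close> left_zero_vec[OF Cz] by simp
  moreover have "inj_on x {0..m}" "x ` {0..m} \<subseteq> {-1..1}"
    using inj range \<open>m \<le> r\<close> \<open>r \<le> n\<close> by (auto simp: inj_on_def image_subset_iff)
  ultimately have "z = 0\<^sub>v (m + 1)"
    using transpose_cheb_mat_injective[OF _ _ \<open>m \<le> r\<close> z] by blast
  then show ?thesis
    using a0 v_eq zero_split by simp
qed

lemma kkt_mat_inverts:
  assumes "inj_on x {0..n}" "x ` {0..n} \<subseteq> {-1..1}" "m \<le> r" "r \<le> n"
  shows "kkt_mat x n m r * mat_inv (kkt_mat x n m r) = 1\<^sub>m (r + m + 2)"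
    "mat_inv (kkt_mat x n m r) * kkt_mat x n m r = 1\<^sub>m (r + m + 2)"
    "mat_inv (kkt_mat x n m r) \<in> carrier_mat (r + m + 2) (r + m + 2)"
  using mat_inv_inverts[OF kkt_mat_carrier] kkt_mat_injective[OF assms] by blast+

text \<open>Evaluating \<open>THE\<close> takes existence, from the right inverse, and uniqueness,
  from the left inverse.\<close>

lemma kkt_solution_solves:
  assumes "inj_on x {0..n}" "x ` {0..n} \<subseteq> {-1..1}" "m \<le> r" "r \<le> n"
  obtains a z where "kkt_solution x n m r f = (a, z)"
    "a \<in> carrier_vec (r + 1)" "z \<in> carrier_vec (m + 1)"
    "a @\<^sub>v z = mat_inv (kkt_mat x n m r) *\<^sub>v kkt_rhs x n m r f"
proof -
  let ?M = "kkt_mat x n m r" and ?b = "kkt_rhs x n m r f"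
  note inv = kkt_mat_inverts[OF assms]
  define w where "w = mat_inv ?M *\<^sub>v ?b"
  have w: "w \<in> carrier_vec ((r + 1) + (m + 1))"
    using mult_mat_vec_carrier[OF inv(3) kkt_rhs_carrier] by (simp add: w_def)
  have iff: "?M *\<^sub>v v = ?b \<longleftrightarrow> v = w" if "v \<in> carrier_vec (r + m + 2)" for v
  proof
    assume "?M *\<^sub>v v = ?b"
    then have "w = (mat_inv ?M * ?M) *\<^sub>v v"
      unfolding w_def using inv(3) that by (simp add: assoc_mult_mat_vec[OF _ kkt_mat_carrier])
    then show "v = w"
      using inv(2) that by simp
  next
    assume "v = w"
    then have "?M *\<^sub>v v = (?M * mat_inv ?M) *\<^sub>v ?b"
      unfolding w_def by (simp add: assoc_mult_mat_vec[OF kkt_mat_carrier inv(3) kkt_rhs_carrier])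
    then show "?M *\<^sub>v v = ?b"
      using inv(1) one_mult_mat_vec[OF kkt_rhs_carrier] by simp
  qed
  let ?a = "vec_first w (r + 1)" and ?z = "vec_last w (m + 1)"
  have w_eq: "?a @\<^sub>v ?z = w"
    using w by simp
  have "kkt_solution x n m r f = (?a, ?z)"
    unfolding kkt_solution_def
  proof (rule the_equality)
    show "case (?a, ?z) of (a, z) \<Rightarrow> a \<in> carrier_vec (r + 1) \<and> z \<in> carrier_vec (m + 1) \<and>
        ?M *\<^sub>v (a @\<^sub>v z) = ?b"
      using iff w w_eq by simp
  next
    fix p
    assume p: "case p of (a, z) \<Rightarrow> a \<in> carrier_vec (r + 1) \<and> z \<in> carrier_vec (m + 1) \<and>
        ?M *\<^sub>v (a @\<^sub>v z) = ?b"
    obtain a z where p_eq: "p = (a, z)"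
      by (cases p)
    with p have az: "a \<in> carrier_vec (r + 1)" "z \<in> carrier_vec (m + 1)" "?M *\<^sub>v (a @\<^sub>v z) = ?b"
      by auto
    then have "a @\<^sub>v z \<in> carrier_vec (r + m + 2)"
      using append_carrier_vec[OF az(1,2)] by simp
    then have "a @\<^sub>v z = ?a @\<^sub>v ?z"
      using iff az(3) w_eq by simp
    then show "p = (?a, ?z)"
      using append_vec_eq[OF az(1), of ?a] p_eq by simp
  qed
  then show ?thesis
    using that[of ?a ?z] w_eq by (simp add: w_def)
qed

section \<open>The error bound\<close>

text \<open>A real supremum bounds its members only if the set is bounded above; continuity on a
  compact interval provides this.\<close>

lemma abs_le_sup_norm:
  assumes "continuous_on {-1..1} g" "t \<in> {-1..1}"
  shows "\<bar>g t\<bar> \<le> sup_norm g"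
proof -
  have "continuous_on {-1..1} (\<lambda>t. \<bar>g t\<bar>)"
    using assms(1) by (intro continuous_intros)
  then obtain s where "\<forall>t\<in>{-1..1}. \<bar>g t\<bar> \<le> \<bar>g s\<bar>"
    using continuous_attains_sup[of "{-1..1::real}" "\<lambda>t. \<bar>g t\<bar>"] by auto
  then have "bdd_above ((\<lambda>t. \<bar>g t\<bar>) ` {-1..1})"
    by (intro bdd_aboveI2) auto
  then show ?thesis
    unfolding sup_norm_def using assms(2) by (intro cSUP_upper)
qed

lemma sup_norm_le:
  assumes "\<And>t. t \<in> {-1..1} \<Longrightarrow> \<bar>g t\<bar> \<le> c"
  shows "sup_norm g \<le> c"
  unfolding sup_norm_def using assms by (intro cSUP_least) auto

lemma equi_nodes_subset: "0 < n \<Longrightarrow> equi_nodes n \<subseteq> {-1..1}"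
  by (auto simp: equi_nodes_def field_simps)

text \<open>Holds for every real \<open>t\<close>, since the cosine is bounded whatever value
  \<open>arccos t\<close> has.\<close>

lemma abs_cheb_sum_le_vec_norm1:
  assumes "c \<in> carrier_vec (r + 1)"
  shows "\<bar>\<Sum>j\<le>r. c $ j * cheb j t\<bar> \<le> vec_norm1 c"
proof -
  have "\<bar>\<Sum>j\<le>r. c $ j * cheb j t\<bar> \<le> (\<Sum>j\<le>r. \<bar>c $ j\<bar> * 1)"
    by (intro order_trans[OF sum_abs] sum_mono, unfold abs_mult)
      (intro mult_left_mono abs_cheb_le_1, auto)
  then show ?thesis
    using assms by (simp add: vec_norm1_def lessThan_Suc_atMost)
qed

text \<open>Stated for any polynomial \<open>q\<close> of degree at most \<open>r\<close>, since
  reproduction and linearity are all that the argument takes from \<open>q\<close>.\<close>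

lemma mock_cheb_ls_error:
  assumes nodes: "inj_on x {0..n}" "x ` {0..n} \<subseteq> {-1..1}" "m \<le> r" "r \<le> n"
    and deg: "degree q \<le> r"
    and e: "\<And>t. t \<in> {-1..1} \<Longrightarrow> \<bar>f t - poly q t\<bar> \<le> e"
    and t: "t \<in> {-1..1}"
  shows "\<bar>poly q t - mock_cheb_ls x n m r f t\<bar>
    \<le> mat_norm1 (mat_inv (kkt_mat x n m r))
      * ((2 * real (r + 1) * real (n + 1) + real (m + 1)) * e)"
proof -
  let ?M = "kkt_mat x n m r" and ?b = "kkt_rhs x n m r"
  note inv = kkt_mat_inverts[OF nodes]
  obtain a z where sol: "kkt_solution x n m r f = (a, z)"
    and a: "a \<in> carrier_vec (r + 1)" and z: "z \<in> carrier_vec (m + 1)"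
    and az: "a @\<^sub>v z = mat_inv ?M *\<^sub>v ?b f"
    by (rule kkt_solution_solves[OF nodes])
  obtain c where c: "c \<in> carrier_vec (r + 1)"
    and q: "\<And>t. t \<in> {-1..1} \<Longrightarrow> (\<Sum>j\<le>r. c $ j * cheb j t) = poly q t"
    using deg by (rule cheb_span) blast
  have c0: "c @\<^sub>v 0\<^sub>v (m + 1) \<in> carrier_vec (r + m + 2)"
    using append_carrier_vec[OF c zero_carrier_vec[of "m + 1"]] by simp
  have "?b (poly q) = ?b (\<lambda>t. \<Sum>j\<le>r. c $ j * cheb j t)"
    using nodes q by (intro kkt_rhs_cong) (auto simp: image_subset_iff)
  then have "mat_inv ?M *\<^sub>v ?b (poly q) = (mat_inv ?M * ?M) *\<^sub>v (c @\<^sub>v 0\<^sub>v (m + 1))"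
    using kkt_mat_mult_coeffs[OF c, of x n m] c0
    by (simp add: assoc_mult_mat_vec[OF inv(3) kkt_mat_carrier])
  then have Mq: "mat_inv ?M *\<^sub>v ?b (poly q) = c @\<^sub>v 0\<^sub>v (m + 1)"
    using inv(2) c0 by simp
  have "mat_inv ?M *\<^sub>v ?b (\<lambda>t. f t - poly q t) = (a @\<^sub>v z) - (c @\<^sub>v 0\<^sub>v (m + 1))"
    unfolding kkt_rhs_diff az Mq[symmetric]
    by (rule mult_minus_distrib_mat_vec[OF inv(3) kkt_rhs_carrier kkt_rhs_carrier])
  also have "\<dots> = (a - c) @\<^sub>v z"
    using a c z by (intro eq_vecI) auto
  finally have diff: "mat_inv ?M *\<^sub>v ?b (\<lambda>t. f t - poly q t) = (a - c) @\<^sub>v z" .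
  have "poly q t - mock_cheb_ls x n m r f t = - (\<Sum>j\<le>r. (a - c) $ j * cheb j t)"
    unfolding mock_cheb_ls_def sol q[OF t, symmetric] using a c
    by (simp add: atLeast0AtMost left_diff_distrib sum_subtractf)
  then have "\<bar>poly q t - mock_cheb_ls x n m r f t\<bar> \<le> vec_norm1 (a - c)"
    using abs_cheb_sum_le_vec_norm1[of "a - c" r t] a c by simp
  \<comment> \<open>The multiplier block \<open>z\<close> contributes a nonnegative amount to the
    norm of the whole solution.\<close>
  also have "\<dots> \<le> vec_norm1 (mat_inv ?M *\<^sub>v ?b (\<lambda>t. f t - poly q t))"
    using diff vec_norm1_nonneg[of z] by (simp add: vec_norm1_append)
  also have "\<dots> \<le> mat_norm1 (mat_inv ?M) * vec_norm1 (?b (\<lambda>t. f t - poly q t))"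
    using inv(3) kkt_rhs_carrier[of x n m r] by (intro vec_norm1_mult_mat_vec_le) simp
  also have "\<dots> \<le> mat_norm1 (mat_inv ?M)
      * ((2 * real (r + 1) * real (n + 1) + real (m + 1)) * e)"
  proof (intro mult_left_mono vec_norm1_kkt_rhs_le)
    show "0 \<le> mat_norm1 (mat_inv ?M)"
      using inv(3) abs_entry_le_mat_norm1[of 0 "mat_inv ?M" 0] by auto
  qed (use nodes e in \<open>auto simp: image_subset_iff\<close>)
  finally show ?thesis .
qed

theorem theorem2:
  fixes n m r :: nat and x x' :: "nat \<Rightarrow> real" and f :: "real \<Rightarrow> real"
    and pstar :: "real poly" and M :: "real mat" and B :: real
  defines "m \<equiv> m_of n"
    and "r \<equiv> r_of n"
    and "M \<equiv> kkt_mat x n m r"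
    and "B \<equiv> 2 * real (r + 1) * cond1 M + real (m + 1) * mat_norm1 (mat_inv M)"
  assumes "0 < n" and "r \<le> n"
    and "mock_chebyshev n m x'"
    and "bij_betw x {0..n} (equi_nodes n)"
    and "\<forall>i\<le>m. x i = x' i"
    and "continuous_on {-1..1} f"
    and "best_uniform_approx r f pstar"
  shows "sup_norm (\<lambda>t. f t - mock_cheb_ls x n m r f t)
       \<le> (1 + B) * sup_norm (\<lambda>t. f t - poly pstar t)"
proof (rule sup_norm_le)
  fix t :: real assume t: "t \<in> {-1..1}"
  define e where "e = sup_norm (\<lambda>t. f t - poly pstar t)"
  \<comment> \<open>Here \<open>m \<le> r\<close> comes from \<open>r = m + p_of n + 1\<close>; the
    other facts come from the enumeration of the grid.\<close>
  have nodes: "inj_on x {0..n}" "x ` {0..n} \<subseteq> {-1..1}" "m \<le> r" "r \<le> n"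
    using assms(8) equi_nodes_subset[OF \<open>0 < n\<close>] \<open>r \<le> n\<close>
    by (auto simp: bij_betw_def m_def r_def r_of_def)
  note inv = kkt_mat_inverts[OF nodes, folded M_def]
  have e: "\<bar>f s - poly pstar s\<bar> \<le> e" if "s \<in> {-1..1}" for s
    unfolding e_def using assms(10) that by (intro abs_le_sup_norm continuous_intros)
  have "degree pstar \<le> r"
    using assms(11) by (simp add: best_uniform_approx_def)
  then have "\<bar>poly pstar t - mock_cheb_ls x n m r f t\<bar>
      \<le> mat_norm1 (mat_inv M) * ((2 * real (r + 1) * real (n + 1) + real (m + 1)) * e)"
    unfolding M_def using mock_cheb_ls_error[OF nodes _ e t] by blast
  \<comment> \<open>Replacing \<open>n + 1\<close> by \<open>mat_norm1 M\<close> makes the product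
    of the two norms appear, which is \<open>cond1 M\<close>.\<close>
  also have "\<dots> \<le> mat_norm1 (mat_inv M) * ((2 * real (r + 1) * mat_norm1 M + real (m + 1)) * e)"
  proof (intro mult_left_mono mult_right_mono add_mono)
    show "real (n + 1) \<le> mat_norm1 M"
      unfolding M_def by (rule Suc_n_le_mat_norm1_kkt_mat)
    show "0 \<le> mat_norm1 (mat_inv M)"
      using inv(3) abs_entry_le_mat_norm1[of 0 "mat_inv M" 0] by auto
    show "0 \<le> e"
      using e[OF t] by linarith
  qed auto
  also have "\<dots> = B * e"
    by (simp add: B_def cond1_def algebra_simps)
  \<comment> \<open>Triangle inequality through \<open>pstar\<close>: its own error gives the
    summand 1 in \<open>1 + B\<close>.\<close>
  finally have "\<bar>f t - mock_cheb_ls x n m r f t\<bar> \<le> e + B * e"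
    using e[OF t] by linarith
  then show "\<bar>f t - mock_cheb_ls x n m r f t\<bar> \<le> (1 + B) * sup_norm (\<lambda>t. f t - poly pstar t)"
    by (simp add: e_def algebra_simps)
qed

end
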